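(* Let $n\ge 1$ and let $A,B$ be $n\times n$ matrices with entries in $\{0,\dots,n-1\}$ such that every row of $A$ and every column of $B$ is a permutation of $\{0,\dots,n-1\}$. Then $$\sum_{i,j} A_{ij}B_{ij}\ \ge\ \frac{n^2(n-1)(n-2)}{6},$$ and equality holds when $A,B$ are the rank-complement matrices of the cyclic Hollow-Shell profile $C_n$.
   Context: For a stable marriage instance with $n$ men and $n$ women indexed by $0,\dots,n-1$, let $r_M(i,j)\in\{1,\dots,n\}$ be the rank of woman $j$ in man $i$'s list and $r_W(j,i)\in\{1,\dots,n\}$ the rank of man $i$ in woman $j$'s list (1 is best). The rank-complement matrices are $A_{ij}=n-r_M(i,j)$ and $B_{ij}=n-r_W(j,i)$. The cyclic Hollow-Shell $C_n$ is the instance with $r_M(g,h)=((h-g)\bmod n)+1$ and $r_W(h,g)=n-((h-g)\bmod n)$, where $\bmod\ n$ takes values in $\{0,\dots,n-1\}$. *)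

theory Defs
  imports Complex_Main "Jordan_Normal_Form.Matrix"
begin

text \<open>
  Men and women are both indexed by \<open>0, \<dots>, n - 1\<close>. A profile is a pair of rank functions
  \<open>rM man woman\<close> and \<open>rW woman man\<close>, with \<open>1\<close> the best rank. Ranks and matrix entries are integers,
  so that no subtraction is truncated.
\<close>

definition stable_marriage_instance ::
  "nat \<Rightarrow> (nat \<Rightarrow> nat \<Rightarrow> int) \<Rightarrow> (nat \<Rightarrow> nat \<Rightarrow> int) \<Rightarrow> bool" where
  "stable_marriage_instance n rM rW \<longleftrightarrow>
     (\<forall>i<n. bij_betw (rM i) {..<n} {1..int n}) \<and>
     (\<forall>j<n. bij_betw (rW j) {..<n} {1..int n})"

text \<open>Both matrices below have a row per man and a column per woman: the arguments of \<open>rW\<close> are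
  swapped.\<close>

definition rank_complement_M :: "nat \<Rightarrow> (nat \<Rightarrow> nat \<Rightarrow> int) \<Rightarrow> int mat" where
  "rank_complement_M n rM = mat n n (\<lambda>(i, j). int n - rM i j)"

definition rank_complement_W :: "nat \<Rightarrow> (nat \<Rightarrow> nat \<Rightarrow> int) \<Rightarrow> int mat" where
  "rank_complement_W n rW = mat n n (\<lambda>(i, j). int n - rW j i)"

definition hollow_shell_M :: "nat \<Rightarrow> nat \<Rightarrow> nat \<Rightarrow> int" where
  "hollow_shell_M n g h = (int h - int g) mod int n + 1"

definition hollow_shell_W :: "nat \<Rightarrow> nat \<Rightarrow> nat \<Rightarrow> int" where
  "hollow_shell_W n h g = int n - (int h - int g) mod int n"

lemma hollow_shell_instance:
  "stable_marriage_instance n (hollow_shell_M n) (hollow_shell_W n)"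
proof -
  have eqI: "x = y" if "int x mod int n = int y mod int n" "x < n" "y < n" for x y
    using that by simp
  have fin: "bij_betw f {..<n} {1..int n}"
    if "inj_on f {..<n}" "f ` {..<n} \<subseteq> {1..int n}" for f :: "nat \<Rightarrow> int"
  proof -
    have "f ` {..<n} = {1..int n}"
      using that by (intro card_subset_eq) (auto simp: card_image)
    with that show ?thesis by (simp add: bij_betw_def)
  qed
  have M: "bij_betw (hollow_shell_M n g) {..<n} {1..int n}" if "g < n" for g
  proof (rule fin)
    show "inj_on (hollow_shell_M n g) {..<n}"
    proof (rule inj_onI)
      fix x y assume xy: "x \<in> {..<n}" "y \<in> {..<n}" "hollow_shell_M n g x = hollow_shell_M n g y"
      then have "((int x - int g) mod int n + int g) mod int n = ((int y - int g) mod int n + int g) mod int n"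
        by (simp add: hollow_shell_M_def)
      then have "int x mod int n = int y mod int n" by (simp only: mod_add_left_eq diff_add_cancel)
      with xy show "x = y" by (intro eqI) auto
    qed
    show "hollow_shell_M n g ` {..<n} \<subseteq> {1..int n}"
      using that pos_mod_bound[of "int n"] pos_mod_sign[of "int n"]
      by (auto simp: hollow_shell_M_def add1_zle_eq)
  qed
  have W: "bij_betw (hollow_shell_W n h) {..<n} {1..int n}" if "h < n" for h
  proof (rule fin)
    show "inj_on (hollow_shell_W n h) {..<n}"
    proof (rule inj_onI)
      fix x y assume xy: "x \<in> {..<n}" "y \<in> {..<n}" "hollow_shell_W n h x = hollow_shell_W n h y"
      then have "(int h - (int h - int x) mod int n) mod int n = (int h - (int h - int y) mod int n) mod int n"
        by (simp add: hollow_shell_W_def)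
      then have "int x mod int n = int y mod int n" by (simp add: mod_diff_right_eq)
      with xy show "x = y" by (intro eqI) auto
    qed
    show "hollow_shell_W n h ` {..<n} \<subseteq> {1..int n}"
    proof (rule image_subsetI)
      fix x
      have "(int h - int x) mod int n < int n" "0 \<le> (int h - int x) mod int n"
        using that by simp_all
      then show "hollow_shell_W n h x \<in> {1..int n}"
        unfolding hollow_shell_W_def atLeastAtMost_iff by linarith
    qed
  qed
  show ?thesis using M W by (simp add: stable_marriage_instance_def)
qed

lemma bij_betw_rank_complement:
  assumes "bij_betw f {..<n} {1..int n}"
  shows "bij_betw (\<lambda>j. int n - f j) {..<n} {0..int n - 1}"
proof -
  have "bij_betw (\<lambda>x. int n - x) {1..int n} {0..int n - 1}"
    by (rule bij_betw_byWitness[where f' = "\<lambda>x. int n - x"]) auto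
  from bij_betw_trans[OF assms this] show ?thesis by (simp add: o_def)
qed

lemma rank_complement_permutations:
  assumes "stable_marriage_instance n rM rW"
  shows "i < n \<Longrightarrow> bij_betw (\<lambda>j. rank_complement_M n rM $$ (i, j)) {..<n} {0..int n - 1}"
    and "j < n \<Longrightarrow> bij_betw (\<lambda>i. rank_complement_W n rW $$ (i, j)) {..<n} {0..int n - 1}"
proof -
  assume "i < n"
  then have "bij_betw (\<lambda>j. int n - rM i j) {..<n} {0..int n - 1}"
    using assms by (intro bij_betw_rank_complement) (auto simp: stable_marriage_instance_def)
  then show "bij_betw (\<lambda>j. rank_complement_M n rM $$ (i, j)) {..<n} {0..int n - 1}"
    using \<open>i < n\<close> by (subst bij_betw_cong[where g = "\<lambda>j. int n - rM i j"]) (auto simp: rank_complement_M_def)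
next
  assume "j < n"
  then have "bij_betw (\<lambda>i. int n - rW j i) {..<n} {0..int n - 1}"
    using assms by (intro bij_betw_rank_complement) (auto simp: stable_marriage_instance_def)
  then show "bij_betw (\<lambda>i. rank_complement_W n rW $$ (i, j)) {..<n} {0..int n - 1}"
    using \<open>j < n\<close> by (subst bij_betw_cong[where g = "\<lambda>i. int n - rW j i"]) (auto simp: rank_complement_W_def)
qed

end

theory Submission
  imports Defs
begin

text \<open>
  Every value \<open>k < n\<close> occurs exactly \<open>n\<close> times in \<open>A\<close> and \<open>n\<close> times in \<open>B\<close>, so the sums of the
  entries and of their squares are fixed. Expanding \<open>\<Sum>(A\<^sub>i\<^sub>j + B\<^sub>i\<^sub>j - (n - 1))\<^sup>2\<close> then expresses
  \<open>\<Sum>A\<^sub>i\<^sub>jB\<^sub>i\<^sub>j\<close> as the claimed bound plus half of this sum of squares. The deviation vanishes for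
  the Hollow-Shell, where \<open>A + B\<close> is constantly \<open>n - 1\<close>.
\<close>

text \<open>Reindexing along \<open>f\<close> and along \<open>int\<close> turns both sums into
  power sums over \<open>k < n\<close>, which are settled by induction. The factors 2 and 6 avoid
  division in the integers.\<close>

lemma sum_bij_betw_atLeast0_int:
  fixes f :: "'a \<Rightarrow> int" and n :: nat
  assumes "bij_betw f S {0..int n - 1}"
  shows "2 * (\<Sum>x\<in>S. f x) = int n * (int n - 1)"
    and "6 * (\<Sum>x\<in>S. (f x)\<^sup>2) = int n * (int n - 1) * (2 * int n - 1)"
proof -
  have int_lessThan: "bij_betw int {..<n} {0..int n - 1}"
    by (rule bij_betw_byWitness[where f' = nat]) auto
  have transfer: "(\<Sum>x\<in>S. g (f x)) = (\<Sum>k<n. g (int k))" for g :: "int \<Rightarrow> int"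
    using sum.reindex_bij_betw[OF assms, of g] sum.reindex_bij_betw[OF int_lessThan, of g] by simp
  have "2 * (\<Sum>k<n. int k) = int n * (int n - 1)"
    by (induction n) (auto simp: algebra_simps)
  then show "2 * (\<Sum>x\<in>S. f x) = int n * (int n - 1)"
    using transfer[of "\<lambda>x. x"] by simp
  have "6 * (\<Sum>k<n. (int k)\<^sup>2) = int n * (int n - 1) * (2 * int n - 1)"
    by (induction n) (auto simp: algebra_simps power2_eq_square)
  then show "6 * (\<Sum>x\<in>S. (f x)\<^sup>2) = int n * (int n - 1) * (2 * int n - 1)"
    using transfer[of "\<lambda>x. x\<^sup>2"] by simp
qed

text \<open>The entries of \<open>a\<close> and of \<open>b\<close> each have mean
  \<open>(n - 1) / 2\<close>, so \<open>n - 1\<close> centres \<open>a i j + b i j\<close>. Being an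
  exact identity, it serves both the bound and the equality case.\<close>

lemma sum_mult_row_column_permutations:
  fixes a b :: "nat \<Rightarrow> nat \<Rightarrow> int"
  assumes rows: "\<And>i. i < n \<Longrightarrow> bij_betw (\<lambda>j. a i j) {..<n} {0..int n - 1}"
    and cols: "\<And>j. j < n \<Longrightarrow> bij_betw (\<lambda>i. b i j) {..<n} {0..int n - 1}"
  shows "6 * (\<Sum>i<n. \<Sum>j<n. a i j * b i j) =
    int n ^ 2 * (int n - 1) * (int n - 2) + 3 * (\<Sum>i<n. \<Sum>j<n. (a i j + b i j - (int n - 1))\<^sup>2)"
proof -
  let ?c = "int n - 1"
  have a1: "2 * (\<Sum>i<n. \<Sum>j<n. a i j) = int n * (int n * ?c)"
    using sum_bij_betw_atLeast0_int(1)[OF rows] by (simp add: sum_distrib_left)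
  have a2: "6 * (\<Sum>i<n. \<Sum>j<n. (a i j)\<^sup>2) = int n * (int n * ?c * (2 * int n - 1))"
    using sum_bij_betw_atLeast0_int(2)[OF rows] by (simp add: sum_distrib_left)
  \<comment> \<open>The permutations in \<open>b\<close> are its columns, so its sums are evaluated
    column by column and then swapped into the order used for \<open>a\<close>.\<close>
  have "2 * (\<Sum>j<n. \<Sum>i<n. b i j) = int n * (int n * ?c)"
    using sum_bij_betw_atLeast0_int(1)[OF cols] by (simp add: sum_distrib_left)
  then have b1: "2 * (\<Sum>i<n. \<Sum>j<n. b i j) = int n * (int n * ?c)"
    by (subst sum.swap)
  have "6 * (\<Sum>j<n. \<Sum>i<n. (b i j)\<^sup>2) = int n * (int n * ?c * (2 * int n - 1))"
    using sum_bij_betw_atLeast0_int(2)[OF cols] by (simp add: sum_distrib_left)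
  then have b2: "6 * (\<Sum>i<n. \<Sum>j<n. (b i j)\<^sup>2) = int n * (int n * ?c * (2 * int n - 1))"
    by (subst sum.swap)
  \<comment> \<open>The grouping \<open>?c * (2 * x)\<close> makes the doubled sums of
    \<open>a1\<close> and \<open>b1\<close> appear literally after summation.\<close>
  have "(x + y - ?c)\<^sup>2 = x\<^sup>2 + y\<^sup>2 + 2 * (x * y) - ?c * (2 * x) - ?c * (2 * y) + ?c\<^sup>2" for x y :: int
    by (simp add: power2_eq_square algebra_simps)
  then have "(\<Sum>i<n. \<Sum>j<n. (a i j + b i j - ?c)\<^sup>2) =
      (\<Sum>i<n. \<Sum>j<n. (a i j)\<^sup>2) + (\<Sum>i<n. \<Sum>j<n. (b i j)\<^sup>2) + 2 * (\<Sum>i<n. \<Sum>j<n. a i j * b i j)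
      - ?c * (2 * (\<Sum>i<n. \<Sum>j<n. a i j)) - ?c * (2 * (\<Sum>i<n. \<Sum>j<n. b i j)) + int n * (int n * ?c\<^sup>2)"
    by (simp only: sum.distrib sum_subtractf sum_distrib_left[symmetric] sum_constant card_lessThan)
  \<comment> \<open>After multiplication by 3, the factor \<open>n - 2\<close> arises as
    \<open>3 * (n - 1) - (2 * n - 1)\<close>.\<close>
  with a2 b2 show ?thesis
    unfolding a1 b1 by (simp add: algebra_simps power2_eq_square)
qed

theorem lemma3p1:
  fixes n :: nat
  assumes "n \<ge> 1"
  shows
    "(\<forall>A B :: int mat.
        A \<in> carrier_mat n n \<longrightarrow> B \<in> carrier_mat n n \<longrightarrow>
        (\<forall>i<n. \<forall>j<n. A $$ (i, j) \<in> {0..int n - 1} \<and> B $$ (i, j) \<in> {0..int n - 1}) \<longrightarrow>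
        (\<forall>i<n. bij_betw (\<lambda>j. A $$ (i, j)) {..<n} {0..int n - 1}) \<longrightarrow>
        (\<forall>j<n. bij_betw (\<lambda>i. B $$ (i, j)) {..<n} {0..int n - 1}) \<longrightarrow>
        real_of_int (\<Sum>i<n. \<Sum>j<n. A $$ (i, j) * B $$ (i, j))
          \<ge> real n ^ 2 * (real n - 1) * (real n - 2) / 6)
     \<and>
     (\<forall>A B :: int mat.
        A = rank_complement_M n (hollow_shell_M n) \<longrightarrow>
        B = rank_complement_W n (hollow_shell_W n) \<longrightarrow>
        real_of_int (\<Sum>i<n. \<Sum>j<n. A $$ (i, j) * B $$ (i, j))
          = real n ^ 2 * (real n - 1) * (real n - 2) / 6)"
proof -
  have bound: "real n ^ 2 * (real n - 1) * (real n - 2) = real_of_int (int n ^ 2 * (int n - 1) * (int n - 2))"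
    by simp
  show ?thesis
  proof (intro conjI allI impI)
    fix A B :: "int mat"
    assume "\<forall>i<n. bij_betw (\<lambda>j. A $$ (i, j)) {..<n} {0..int n - 1}"
      and "\<forall>j<n. bij_betw (\<lambda>i. B $$ (i, j)) {..<n} {0..int n - 1}"
    then have "6 * (\<Sum>i<n. \<Sum>j<n. A $$ (i, j) * B $$ (i, j)) = int n ^ 2 * (int n - 1) * (int n - 2)
        + 3 * (\<Sum>i<n. \<Sum>j<n. (A $$ (i, j) + B $$ (i, j) - (int n - 1))\<^sup>2)"
      by (intro sum_mult_row_column_permutations) auto
    moreover have "0 \<le> (\<Sum>i<n. \<Sum>j<n. (A $$ (i, j) + B $$ (i, j) - (int n - 1))\<^sup>2)"
      by (intro sum_nonneg) simp
    ultimately have "int n ^ 2 * (int n - 1) * (int n - 2) \<le> 6 * (\<Sum>i<n. \<Sum>j<n. A $$ (i, j) * B $$ (i, j))"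
      by linarith
    then show "real_of_int (\<Sum>i<n. \<Sum>j<n. A $$ (i, j) * B $$ (i, j))
        \<ge> real n ^ 2 * (real n - 1) * (real n - 2) / 6"
      unfolding bound by linarith
  next
    fix A B :: "int mat"
    assume A: "A = rank_complement_M n (hollow_shell_M n)"
      and B: "B = rank_complement_W n (hollow_shell_W n)"
    have "6 * (\<Sum>i<n. \<Sum>j<n. A $$ (i, j) * B $$ (i, j)) = int n ^ 2 * (int n - 1) * (int n - 2)
        + 3 * (\<Sum>i<n. \<Sum>j<n. (A $$ (i, j) + B $$ (i, j) - (int n - 1))\<^sup>2)"
      unfolding A B
      by (intro sum_mult_row_column_permutations rank_complement_permutations[OF hollow_shell_instance])
    \<comment> \<open>With \<open>d = (j - i) mod n\<close>, the entries are
      \<open>n - 1 - d\<close> in \<open>A\<close> and \<open>d\<close> in \<open>B\<close>, so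
      every summand is zero.\<close>
    moreover have "(\<Sum>i<n. \<Sum>j<n. (A $$ (i, j) + B $$ (i, j) - (int n - 1))\<^sup>2) = 0"
      by (intro sum.neutral)
        (simp add: A B rank_complement_M_def rank_complement_W_def hollow_shell_M_def hollow_shell_W_def)
    ultimately have "6 * (\<Sum>i<n. \<Sum>j<n. A $$ (i, j) * B $$ (i, j)) = int n ^ 2 * (int n - 1) * (int n - 2)"
      by linarith
    then show "real_of_int (\<Sum>i<n. \<Sum>j<n. A $$ (i, j) * B $$ (i, j))
        = real n ^ 2 * (real n - 1) * (real n - 2) / 6"
      unfolding bound by linarith
  qed
qed

end
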